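(* For any integer $s\ge 4$, \[R_2(s)\le\frac{5s}{8(s-1)}.\]
   Context: All invertibility is over $\mathbb{F}_2$. For an $s\times s$ invertible $0$-$1$ matrix $M$, $N_2(M)$ is the number of invertible $2\times2$ submatrices of $M$ (one for each choice of two rows and two columns), $R_2(M)=N_2(M)/\binom{s}{2}^2$, and $R_2(s)=\max\{R_2(M): M \text{ is an } s\times s \text{ invertible } 0\text{-}1 \text{ matrix}\}$. *)

theory Defs
  imports "HOL-Library.Z2" "Jordan_Normal_Form.DL_Submatrix"
begin

(* 0-1 matrices, with all invertibility over F_2, are matrices over the two-element field bit.
   A 2 x 2 submatrix is given by the pair (I, J) of its row and column index sets. *)

definition N2 :: "bit mat \<Rightarrow> nat" where
  "N2 M = card {(I, J). I \<subseteq> {..<dim_row M} \<and> card I = 2 \<and> J \<subseteq> {..<dim_col M} \<and> card J = 2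
                  \<and> invertible_mat (submatrix M I J)}"

definition R2_mat :: "bit mat \<Rightarrow> real" where
  "R2_mat M = real (N2 M) / (real (dim_row M choose 2))\<^sup>2"

definition R2 :: "nat \<Rightarrow> real" where
  "R2 s = Max {R2_mat M | M. M \<in> carrier_mat s s \<and> invertible_mat M}"

(* The maximum is taken over a finite nonempty set, so Max is never applied outside its
   intended domain. *)

lemma R2_values_finite: "finite {R2_mat M | M. M \<in> carrier_mat s s \<and> invertible_mat M}"
proof -
  let ?K = "card (Pow {..<s} \<times> Pow {..<s})"
  have "{R2_mat M | M. M \<in> carrier_mat s s \<and> invertible_mat M}
      \<subseteq> (\<lambda>k. real k / (real (s choose 2))\<^sup>2) ` {..?K}"
  proof
    fix x assume "x \<in> {R2_mat M | M. M \<in> carrier_mat s s \<and> invertible_mat M}"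
    then obtain M where x: "x = R2_mat M" and M: "M \<in> carrier_mat s s" by blast
    have "N2 M \<le> ?K"
      unfolding N2_def using M by (intro card_mono) auto
    then show "x \<in> (\<lambda>k. real k / (real (s choose 2))\<^sup>2) ` {..?K}"
      using M by (auto simp: x R2_mat_def)
  qed
  then show ?thesis by (rule finite_subset) simp
qed

lemma R2_values_nonempty: "{R2_mat M | M. M \<in> carrier_mat s s \<and> invertible_mat M} \<noteq> {}"
proof -
  have "invertible_mat (1\<^sub>m s :: bit mat)"
    unfolding invertible_mat_def inverts_mat_def by (intro conjI exI[of _ "1\<^sub>m s"]) auto
  then show ?thesis by (auto intro!: exI[of _ "1\<^sub>m s"])
qed

end

theory Submission
  imports Defs "HOL-Analysis.Convex"
begin

text \<open>
  For rows \<open>i\<close>, \<open>j\<close> with supports of sizes \<open>n\<^sub>i\<close>, \<open>n\<^sub>j\<close> meeting in \<open>c\<^sub>i\<^sub>j\<close> columns, exactly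
  \<open>n\<^sub>i n\<^sub>j - c\<^sub>i\<^sub>j\<^sup>2\<close> column pairs give an invertible submatrix, so twice the number of these
  submatrices is at most \<open>N\<^sup>2 - \<Sum> c\<^sub>i\<^sub>j\<^sup>2\<close>, where \<open>N\<close> is the number of ones and the sum runs over
  all \<open>i\<close>, \<open>j\<close>. The sum of the \<open>c\<^sub>i\<^sub>j\<close> is the sum of the squares of the column sums \<open>d\<close>; an
  integrality argument (needed only for \<open>s = 4\<close>) bounds each \<open>d\<^sup>2\<close> below by a linear function of \<open>d\<close>, and hence
  the average of the off-diagonal \<open>c\<^sub>i\<^sub>j\<close> below by \<open>\<gamma> = 3N/(2s) - 5s/8\<close>. By convexity, if \<open>\<gamma> \<ge> 0\<close> then
  \<open>\<Sum> c\<^sub>i\<^sub>j\<^sup>2 \<ge> N\<^sup>2/s + s(s-1)\<gamma>\<^sup>2\<close>, and what remains is a concave quadratic in \<open>N\<close>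
  with its maximum at \<open>N = 3s\<^sup>2/4\<close>; if \<open>\<gamma> < 0\<close> then \<open>N\<^sup>2\<close> is already small enough.
\<close>

text \<open>Determinants of order two are multiplicative: an inverse \<open>B\<close> forces det
  \<open>A\<close> * det \<open>B\<close> = 1, so det \<open>A\<close> cannot vanish.\<close>

lemma invertible_mat_2_det:
  fixes A :: "'a :: comm_ring_1 mat"
  assumes A: "A \<in> carrier_mat 2 2" and inv: "invertible_mat A"
  shows "A $$ (0,0) * A $$ (1,1) \<noteq> A $$ (0,1) * A $$ (1,0)"
proof
  assume eq: "A $$ (0,0) * A $$ (1,1) = A $$ (0,1) * A $$ (1,0)"
  obtain B where AB: "A * B = 1\<^sub>m 2" and BA: "B * A = 1\<^sub>m (dim_row B)"
    using inv A unfolding invertible_mat_def inverts_mat_def by auto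
  from AB have "dim_col B = 2"
    by (metis index_mult_mat(3) index_one_mat(3))
  moreover from BA have "dim_row B = 2"
    using A by (metis carrier_matD(2) index_mult_mat(3) index_one_mat(3))
  ultimately have B: "B \<in> carrier_mat 2 2" by auto
  have entry: "A $$ (i,0) * B $$ (0,j) + A $$ (i,1) * B $$ (1,j) = (if i = j then 1 else 0)"
    if "i < 2" "j < 2" for i j
  proof -
    have "(A * B) $$ (i,j) = A $$ (i,0) * B $$ (0,j) + A $$ (i,1) * B $$ (1,j)"
      using that A B by (simp add: scalar_prod_def numeral_2_eq_2)
    then show ?thesis using that AB by simp
  qed
  have "(A $$ (0,0) * A $$ (1,1) - A $$ (0,1) * A $$ (1,0)) *
        (B $$ (0,0) * B $$ (1,1) - B $$ (0,1) * B $$ (1,0)) =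
        (A $$ (0,0) * B $$ (0,0) + A $$ (0,1) * B $$ (1,0)) *
        (A $$ (1,0) * B $$ (0,1) + A $$ (1,1) * B $$ (1,1)) -
        (A $$ (0,0) * B $$ (0,1) + A $$ (0,1) * B $$ (1,1)) *
        (A $$ (1,0) * B $$ (0,0) + A $$ (1,1) * B $$ (1,0))"
    by (simp add: algebra_simps)
  also have "\<dots> = 1"
    using entry[of 0 0] entry[of 0 1] entry[of 1 0] entry[of 1 1] by simp
  finally show False using eq by simp
qed

lemma submatrix_pair_invertible:
  fixes M :: "'a :: comm_ring_1 mat"
  assumes "a < b" "b < dim_row M" "c < d" "d < dim_col M"
    and "invertible_mat (submatrix M {a,b} {c,d})"
  shows "M $$ (a,c) * M $$ (b,d) \<noteq> M $$ (a,d) * M $$ (b,c)"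
proof -
  let ?S = "submatrix M {a,b} {c,d}"
  have r: "{x \<in> {a,b}. x < a} = {}" "{x \<in> {a,b}. x < b} = {a}"
    and k: "{x \<in> {c,d}. x < c} = {}" "{x \<in> {c,d}. x < d} = {c}"
    using assms by auto
  have "{i. i < dim_row M \<and> i \<in> {a,b}} = {a,b}"
    and "{j. j < dim_col M \<and> j \<in> {c,d}} = {c,d}"
    using assms by auto
  then have "dim_row ?S = card {a,b}" "dim_col ?S = card {c,d}"
    by (simp_all only: dim_submatrix)
  then have S: "?S \<in> carrier_mat 2 2"
    using assms(1,3) by (intro carrier_matI) simp_all
  have "?S $$ (0,0) = M $$ (a,c)" "?S $$ (0,1) = M $$ (a,d)"
       "?S $$ (1,0) = M $$ (b,c)" "?S $$ (1,1) = M $$ (b,d)"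
    using submatrix_index_card[of a M c "{a,b}" "{c,d}"]
      submatrix_index_card[of a M d "{a,b}" "{c,d}"]
      submatrix_index_card[of b M c "{a,b}" "{c,d}"]
      submatrix_index_card[of b M d "{a,b}" "{c,d}"] assms(1-4)
    unfolding r k by simp_all
  then show ?thesis using invertible_mat_2_det[OF S assms(5)] by simp
qed

definition row_support :: "bit mat \<Rightarrow> nat \<Rightarrow> nat set" where
  "row_support M i = {k. k < dim_col M \<and> M $$ (i,k) = 1}"

lemma N2_le_sum_supports:
  "2 * real (N2 M) \<le> (\<Sum>i<dim_row M. \<Sum>j<dim_row M.
     real (card (row_support M i)) * real (card (row_support M j))
       - (real (card (row_support M i \<inter> row_support M j)))\<^sup>2)"
proof -
  let ?s = "dim_row M" and ?A = "row_support M"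
  \<comment> \<open>A pair \<open>(p, q)\<close> lies in \<open>T i j\<close> iff the product of the
    entries at \<open>(i, p)\<close> and \<open>(j, q)\<close> is 1 while that at
    \<open>(i, q)\<close> and \<open>(j, p)\<close> is 0. In particular \<open>T i i\<close> is
    empty, so diagonal terms add nothing.\<close>
  define T where "T i j = ?A i \<times> ?A j - (?A i \<inter> ?A j) \<times> (?A i \<inter> ?A j)" for i j
  define Q where "Q = (SIGMA ij:{..<?s} \<times> {..<?s}. T (fst ij) (snd ij))"
  define L where "L = {((i, j), (p, q)). ((i, j), (p, q)) \<in> Q \<and> i < j}"
  \<comment> \<open>Reversing both pairs preserves \<open>Q\<close> but turns i < j into i > j.
    Hence \<open>L\<close> and its image are disjoint in \<open>Q\<close>, which gives the factor
    2.\<close>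
  define sw :: "(nat \<times> nat) \<times> nat \<times> nat \<Rightarrow> (nat \<times> nat) \<times> nat \<times> nat"
    where "sw = (\<lambda>((i, j), (p, q)). ((j, i), (q, p)))"
  have finA: "finite (?A i)" for i unfolding row_support_def by simp
  have finT: "finite (T i j)" for i j unfolding T_def using finA by blast
  have finQ: "finite Q" unfolding Q_def using finT by blast
  have finL: "finite L" by (rule finite_subset[OF _ finQ]) (auto simp: L_def)
  have "{(I, J). I \<subseteq> {..<?s} \<and> card I = 2 \<and> J \<subseteq> {..<dim_col M} \<and> card J = 2
          \<and> invertible_mat (submatrix M I J)}
        \<subseteq> (\<lambda>((i, j), (p, q)). ({i, j}, {p, q})) ` L" (is "?X \<subseteq> ?f ` L")
  proof (rule subrelI, unfold mem_Collect_eq case_prod_conv, elim conjE)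
    fix I J
    assume I: "I \<subseteq> {..<?s}" "card I = 2" and J: "J \<subseteq> {..<dim_col M}" "card J = 2"
      and inv: "invertible_mat (submatrix M I J)"
    have ordered: "\<exists>a b. K = {a,b} \<and> a < b" if K: "card K = 2" for K :: "nat set"
    proof -
      from K obtain a b where "K = {a,b}" "a \<noteq> b" by (auto simp: card_2_iff)
      then show ?thesis by (metis insert_commute linorder_neqE_nat)
    qed
    obtain a b where ab: "I = {a,b}" "a < b" using ordered[OF I(2)] by blast
    obtain c d where cd: "J = {c,d}" "c < d" using ordered[OF J(2)] by blast
    have lt: "a < ?s" "b < ?s" "c < dim_col M" "d < dim_col M" using I(1) J(1) ab cd by auto
    have "M $$ (a,c) * M $$ (b,d) \<noteq> M $$ (a,d) * M $$ (b,c)"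
      using submatrix_pair_invertible ab cd lt inv by blast
    \<comment> \<open>Over the two-element field, unequal products mean that exactly one of them is
      1; which one decides the order of the columns.\<close>
    then consider "((a,b),(c,d)) \<in> L" | "((a,b),(d,c)) \<in> L"
      using lt ab(2) unfolding L_def Q_def T_def row_support_def
      by (cases "M $$ (a,c)"; cases "M $$ (b,d)"; cases "M $$ (a,d)"; cases "M $$ (b,c)") auto
    then show "(I, J) \<in> ?f ` L"
    proof cases
      case 1
      then show ?thesis using ab cd by (intro image_eqI) auto
    next
      case 2
      then show ?thesis using ab cd by (intro image_eqI) auto
    qed
  qed
  then have N2L: "N2 M \<le> card L"
    unfolding N2_def by (rule order_trans[OF card_mono[OF finite_imageI[OF finL]] card_image_le[OF finL]])
  have "card (sw ` L) = card L" by (rule card_image) (auto simp: inj_on_def sw_def)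
  moreover have "L \<inter> sw ` L = {}" by (auto simp: L_def sw_def)
  ultimately have "2 * card L = card (L \<union> sw ` L)"
    using finL by (simp add: card_Un_disjoint)
  also have "\<dots> \<le> card Q"
    by (rule card_mono[OF finQ]) (auto simp: L_def sw_def Q_def T_def)
  also have "\<dots> = (\<Sum>ij\<in>{..<?s} \<times> {..<?s}. card (T (fst ij) (snd ij)))"
    unfolding Q_def using finT by simp
  also have "\<dots> = (\<Sum>i<?s. \<Sum>j<?s. card (T i j))"
    by (simp add: sum.cartesian_product case_prod_unfold)
  finally have "2 * real (N2 M) \<le> real (\<Sum>i<?s. \<Sum>j<?s. card (T i j))"
    using N2L by linarith
  moreover have "real (card (T i j)) = real (card (?A i)) * real (card (?A j))
       - (real (card (?A i \<inter> ?A j)))\<^sup>2" for i j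
  proof -
    have le: "card (?A i \<inter> ?A j) * card (?A i \<inter> ?A j) \<le> card (?A i) * card (?A j)"
      using finA by (intro mult_mono card_mono) auto
    have "card (T i j) = card (?A i) * card (?A j) - card (?A i \<inter> ?A j) * card (?A i \<inter> ?A j)"
      unfolding T_def using finA by (subst card_Diff_subset) auto
    then show ?thesis using le by (simp add: of_nat_diff power2_eq_square)
  qed
  ultimately show ?thesis by simp
qed

text \<open>Summed over all columns, the right side becomes the sum of the off-diagonal
  \<open>c i j\<close>, and the left side becomes s(s-1)\<gamma>. For s = 4 there is equality at d =
  3.\<close>

lemma column_bound:
  assumes "s \<ge> 4"
  shows "3 / 2 * (real s - 1) * real d - 5 / 8 * real s * (real s - 1)
           \<le> (real d)\<^sup>2 - real d"
proof (cases "s = 4")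
  case True
  \<comment> \<open>The difference of the two sides has roots 5/2 and 3, and no integer lies
    strictly between them.\<close>
  have "(d \<le> 2) \<or> d \<ge> 3" by linarith
  then have "0 \<le> (real d - 5/2) * (real d - 3)"
    by (auto simp: zero_le_mult_iff)
  then show ?thesis using True by (simp add: field_simps power2_eq_square)
next
  case False
  \<comment> \<open>The quadratic in \<open>d\<close> has discriminant a negative multiple of \<open>s\<^sup>2 - 4s - 1\<close>.\<close>
  then have "0 \<le> (real s - 5) * (real s + 1)" using assms by simp
  moreover have "0 \<le> (4 * real d - (3 * real s - 1))\<^sup>2" by simp
  ultimately show ?thesis by (simp add: field_simps power2_eq_square)
qed

lemma sum_supports_bound:
  fixes A :: "nat \<Rightarrow> nat set"
  assumes s: "s \<ge> 4" and A: "\<And>i. i < s \<Longrightarrow> A i \<subseteq> {..<s}"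
  shows "(\<Sum>i<s. \<Sum>j<s. real (card (A i)) * real (card (A j)) - (real (card (A i \<inter> A j)))\<^sup>2)
           \<le> 5 / 16 * real s ^ 3 * (real s - 1)"
proof -
  define n where "n i = real (card (A i))" for i
  define c where "c i j = real (card (A i \<inter> A j))" for i j
  define d where "d k = card {i. i < s \<and> k \<in> A i}" for k
  define N where "N = (\<Sum>i<s. n i)"
  define g where "g = 3 * N / (2 * real s) - 5 * real s / 8"
  have s0: "real s > 0" "real s \<ge> 4" using s by auto
  have ind: "real (card (B \<inter> {..<s})) = (\<Sum>k<s. of_bool (k \<in> B))" for B :: "nat set"
    by (simp add: Int_commute)
  have n_eq: "n i = (\<Sum>k<s. of_bool (k \<in> A i))" if "i < s" for i
    using ind[of "A i"] A[OF that] by (simp add: n_def Int_absorb2)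
  have c_eq: "c i j = (\<Sum>k<s. of_bool (k \<in> A i) * of_bool (k \<in> A j))" if "i < s" for i j
  proof -
    have "A i \<inter> A j \<inter> {..<s} = A i \<inter> A j" using A[OF that] by blast
    then show ?thesis using ind[of "A i \<inter> A j"] by (simp add: c_def of_bool_conj)
  qed
  have d_eq: "real (d k) = (\<Sum>i<s. of_bool (k \<in> A i))" for k
  proof -
    have "{i. i < s \<and> k \<in> A i} = {i. k \<in> A i} \<inter> {..<s}" by auto
    then show ?thesis using ind[of "{i. k \<in> A i}"] by (simp add: d_def)
  qed
  have sum_d: "(\<Sum>k<s. real (d k)) = N"
    unfolding N_def d_eq by (subst sum.swap) (simp add: n_eq)
  \<comment> \<open>Double count the triples (i, j, k) with k in both \<open>A i\<close> and
    \<open>A j\<close>.\<close>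
  have sum_c: "(\<Sum>i<s. \<Sum>j<s. c i j) = (\<Sum>k<s. (real (d k))\<^sup>2)"
  proof -
    have "(\<Sum>i<s. \<Sum>j<s. c i j)
        = (\<Sum>i<s. \<Sum>j<s. \<Sum>k<s. of_bool (k \<in> A i) * of_bool (k \<in> A j))"
      by (simp add: c_eq)
    also have "\<dots> = (\<Sum>i<s. \<Sum>k<s. \<Sum>j<s. of_bool (k \<in> A i) * of_bool (k \<in> A j))"
      by (intro sum.cong refl sum.swap)
    also have "\<dots> = (\<Sum>k<s. \<Sum>i<s. \<Sum>j<s. of_bool (k \<in> A i) * of_bool (k \<in> A j))"
      by (rule sum.swap)
    also have "\<dots> = (\<Sum>k<s. (real (d k))\<^sup>2)"
      unfolding d_eq power2_eq_square sum_product ..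
    finally show ?thesis .
  qed
  have "3 / 2 * (real s - 1) * N - real s * (5 / 8 * real s * (real s - 1))
      = (\<Sum>k<s. 3 / 2 * (real s - 1) * real (d k) - 5 / 8 * real s * (real s - 1))"
    by (simp only: sum_subtractf sum_distrib_left[symmetric] sum_d sum_constant card_lessThan)
      (simp add: algebra_simps)
  also have "\<dots> \<le> (\<Sum>k<s. (real (d k))\<^sup>2 - real (d k))"
    by (intro sum_mono column_bound s)
  also have "\<dots> = (\<Sum>i<s. \<Sum>j<s. c i j) - N"
    by (simp add: sum_subtractf sum_d sum_c)
  finally have lower: "3 / 2 * (real s - 1) * N - real s * (5 / 8 * real s * (real s - 1))
      \<le> (\<Sum>i<s. \<Sum>j<s. c i j) - N" .
  have "real s * (real s - 1) * g
      = 3 / 2 * (real s - 1) * N - real s * (5 / 8 * real s * (real s - 1))"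
    using s0 by (simp add: g_def field_simps)
  with lower have off_diag: "real s * (real s - 1) * g \<le> (\<Sum>i<s. \<Sum>j<s. c i j) - N"
    by (rule ord_eq_le_trans[rotated])
  have "(\<Sum>i<s. n i)\<^sup>2 \<le> (\<Sum>i<s. (n i)\<^sup>2) * card {..<s}"
    by (rule sum_squared_le_sum_of_squares)
  then have diag: "N\<^sup>2 / real s \<le> (\<Sum>i<s. (n i)\<^sup>2)"
    using s0 by (simp add: N_def field_simps)
  have "(\<Sum>i<s. \<Sum>j<s. n i * n j - (c i j)\<^sup>2) = N\<^sup>2 - (\<Sum>i<s. \<Sum>j<s. (c i j)\<^sup>2)"
    by (simp add: sum_subtractf N_def power2_eq_square sum_product)
  also have "\<dots> \<le> 5 / 16 * real s ^ 3 * (real s - 1)"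
  proof (cases "g \<ge> 0")
    case True
    \<comment> \<open>Off the diagonal, each square is bounded below by the tangent to the parabola
      at \<open>g\<close>; the diagonal entry \<open>c i i = n i\<close> keeps its exact
      square.\<close>
    have "(\<Sum>j<s. 2 * g * c i j - g\<^sup>2) - (2 * g * n i - g\<^sup>2) + (n i)\<^sup>2 \<le> (\<Sum>j<s. (c i j)\<^sup>2)"
      if "i < s" for i
    proof -
      have "2 * g * x - g\<^sup>2 \<le> x\<^sup>2" for x
        using zero_le_power2[of "x - g"] by (simp add: power2_eq_square algebra_simps)
      then have "(\<Sum>j\<in>{..<s} - {i}. 2 * g * c i j - g\<^sup>2) \<le> (\<Sum>j\<in>{..<s} - {i}. (c i j)\<^sup>2)"
        by (intro sum_mono)
      moreover have "c i i = n i" by (simp add: c_def n_def)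
      ultimately show ?thesis
        using that sum.remove[of "{..<s}" i "\<lambda>j. 2 * g * c i j - g\<^sup>2"]
          sum.remove[of "{..<s}" i "\<lambda>j. (c i j)\<^sup>2"] by simp
    qed
    then have "(\<Sum>i<s. (\<Sum>j<s. 2 * g * c i j - g\<^sup>2) - (2 * g * n i - g\<^sup>2) + (n i)\<^sup>2)
        \<le> (\<Sum>i<s. \<Sum>j<s. (c i j)\<^sup>2)"
      by (intro sum_mono) simp
    moreover have "(\<Sum>i<s. (\<Sum>j<s. 2 * g * c i j - g\<^sup>2) - (2 * g * n i - g\<^sup>2) + (n i)\<^sup>2)
        = 2 * g * ((\<Sum>i<s. \<Sum>j<s. c i j) - N) - real s * (real s - 1) * g\<^sup>2 + (\<Sum>i<s. (n i)\<^sup>2)"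
      by (simp add: sum.distrib sum_subtractf sum_distrib_left[symmetric]
          sum_distrib_right[symmetric] N_def algebra_simps)
    \<comment> \<open>The sign of \<open>g\<close> matters here: a lower bound is multiplied by
      2g.\<close>
    moreover have "2 * g * (real s * (real s - 1) * g) \<le> 2 * g * ((\<Sum>i<s. \<Sum>j<s. c i j) - N)"
      using True off_diag by (intro mult_left_mono) auto
    ultimately have "real s * (real s - 1) * g\<^sup>2 + N\<^sup>2 / real s \<le> (\<Sum>i<s. \<Sum>j<s. (c i j)\<^sup>2)"
      using diag by (simp add: power2_eq_square algebra_simps)
    moreover
    \<comment> \<open>With the density \<open>m\<close> of ones as variable, the powers of s factor
      out and a quadratic in \<open>m\<close> alone remains.\<close>
    define m where "m = N / (real s)\<^sup>2"
    have N: "N = m * (real s)\<^sup>2" using s0 by (simp add: m_def)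
    have g: "g = real s * (3 / 2 * m - 5 / 8)"
      using s0 by (simp add: g_def N power2_eq_square algebra_simps)
    \<comment> \<open>The gap between the two sides is 5/4 times (m - 3/4) squared.\<close>
    have "m\<^sup>2 - (3 / 2 * m - 5 / 8)\<^sup>2 \<le> 5 / 16"
      using zero_le_power2[of "m - 3 / 4"] by (simp add: power2_eq_square field_simps)
    then have "real s ^ 3 * (real s - 1) * (m\<^sup>2 - (3 / 2 * m - 5 / 8)\<^sup>2)
        \<le> real s ^ 3 * (real s - 1) * (5 / 16)"
      using s0 by (intro mult_left_mono) auto
    moreover have "N\<^sup>2 - N\<^sup>2 / real s - real s * (real s - 1) * g\<^sup>2
        = real s ^ 3 * (real s - 1) * (m\<^sup>2 - (3 / 2 * m - 5 / 8)\<^sup>2)"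
      using s0 unfolding N g by (simp add: power2_eq_square power3_eq_cube field_simps)
    ultimately show ?thesis by (simp add: algebra_simps)
  next
    case False
    then have "N \<le> 5 / 12 * (real s)\<^sup>2"
      using s0 by (simp add: g_def field_simps power2_eq_square)
    moreover have "0 \<le> N" by (simp add: N_def n_def sum_nonneg)
    ultimately have "N\<^sup>2 \<le> (5 / 12 * (real s)\<^sup>2)\<^sup>2" by (rule power_mono)
    also have "\<dots> = real s ^ 3 * (25 / 144 * real s)"
      by (simp add: power2_eq_square power3_eq_cube)
    \<comment> \<open>Comparing the linear factors, this amounts to s \<ge> 9/4.\<close>
    also have "\<dots> \<le> real s ^ 3 * (5 / 16 * (real s - 1))"
      using s0 by (intro mult_left_mono) auto
    moreover have "0 \<le> (\<Sum>i<s. \<Sum>j<s. (c i j)\<^sup>2)" by (intro sum_nonneg) simp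
    ultimately show ?thesis by (simp add: algebra_simps)
  qed
  finally show ?thesis unfolding n_def c_def .
qed

lemma R2_mat_bound:
  assumes s: "s \<ge> 4" and M: "M \<in> carrier_mat s s"
  shows "R2_mat M \<le> 5 * real s / (8 * (real s - 1))"
proof -
  have s0: "real s \<ge> 4" using s by simp
  have "row_support M i \<subseteq> {..<s}" for i using M by (auto simp: row_support_def)
  then have "2 * real (N2 M) \<le> 5 / 16 * real s ^ 3 * (real s - 1)"
    using N2_le_sum_supports[of M] sum_supports_bound[OF s, of "row_support M"] M by simp
  moreover have "real (s choose 2) = real s * (real s - 1) / 2"
    using s by (simp add: choose_two real_of_nat_div of_nat_diff)
  \<comment> \<open>The constant 5/32 is half of 5/16, since the support bound controls twice
    \<open>N2 M\<close>.\<close>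
  moreover have "5 / 32 * real s ^ 3 * (real s - 1) / (real s * (real s - 1) / 2)\<^sup>2
      = 5 * real s / (8 * (real s - 1))"
    using s0 by (simp add: power2_eq_square power3_eq_cube divide_simps)
  moreover have "real (N2 M) / x \<le> 5 / 32 * real s ^ 3 * (real s - 1) / x"
    if "2 * real (N2 M) \<le> 5 / 16 * real s ^ 3 * (real s - 1)" "x \<ge> 0" for x :: real
    using that by (intro divide_right_mono) auto
  ultimately show ?thesis
    using M by (metis R2_mat_def carrier_matD(1) zero_le_power2)
qed

theorem corollary4p4:
  fixes s :: nat
  assumes "s \<ge> 4"
  shows "R2 s \<le> 5 * real s / (8 * (real s - 1))"
proof -
  have "\<forall>x \<in> {R2_mat M | M. M \<in> carrier_mat s s \<and> invertible_mat M}.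
      x \<le> 5 * real s / (8 * (real s - 1))"
    using R2_mat_bound[OF assms] by blast
  then show ?thesis
    unfolding R2_def using R2_values_finite R2_values_nonempty by (subst Max_le_iff)
qed

end
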